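(* Let $n\geq 4$ and $0\le p\le 1$. In the $n$-dimensional bubble-sort network $B_n$ under the random node fault model in which each node is fault-free independently with probability $p$, $$P(3,0,1)=\tfrac{4}{3}(8n^5-50n^4+115n^3-115n^2+42n)p^{4(n-2)!}+(8n^6-74n^5+265n^4-460n^3+387n^2-126n)p^{4(n-2)!-(n-4)!}+(2n^7-25n^6+125n^5-320n^4+443n^3-315n^2+90n)p^{4(n-2)!-2(n-4)!}+\tfrac{1}{6}(n^8-16n^7+105n^6-365n^5+724n^4-819n^3+490n^2-120n)p^{4(n-2)!-3(n-4)!}.$$
   Context: Let $N_n=\{1,\dots,n\}$. The bubble-sort network $B_n$ has as vertices the permutations of $N_n$, written as strings $u_1u_2\cdots u_n$, two permutations being adjacent iff they differ by swapping two adjacent positions $u_i,u_{i+1}$. For distinct $a_1,a_2\in N_n$, a $B_{n-2}$-subnetwork of $B_n$ is one of the following vertex sets (each inducing a copy of $B_{n-2}$ and having $(n-2)!$ vertices): $a_1a_2X^{n-2}$, the set of permutations with $u_1=a_1,u_2=a_2$ ("prefix form"); $a_1X^{n-2}a_2$, the set with $u_1=a_1,u_n=a_2$ ("middle form"); $X^{n-2}a_1a_2$, the set with $u_{n-1}=a_1,u_n=a_2$ ("suffix form"). Each form gives $n(n-1)$ subnetworks. In the random node fault model each vertex is fault-free independently with probability $p$ (faulty with probability $1-p$); a subnetwork is fault-free if all its vertices are. For nonnegative integers $i,j,k$ with $i+j+k=4$, $P(i,j,k)$ denotes the sum, over all sets $S$ of four distinct $B_{n-2}$-subnetworks consisting of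 $i$ of prefix form, $j$ of middle form and $k$ of suffix form, of the probability that all four members of $S$ are fault-free, i.e. of $p^{|\bigcup_{H\in S}H|}$. (The paper calls $P(i,j,k)$ "the probability that there are four fault-free $B_{n-2}$'s, $i$ of which are of prefix form, $j$ of middle form and $k$ of suffix form".) *)

theory Defs
  imports "HOL-Probability.Probability" "HOL-Probability.Product_PMF"
    "HOL-Combinatorics.Multiset_Permutations" "Graph_Theory.Pair_Digraph"
begin

text \<open>The string \<open>u\<^sub>1 \<dots> u\<^sub>n\<close> is the list \<open>u\<close> with \<open>u\<^sub>i = u ! (i - 1)\<close>;
  each undirected edge is a pair of opposite arcs.\<close>

definition bubble_sort :: "nat \<Rightarrow> nat list pair_pre_digraph" where
  "bubble_sort n =
    \<lparr> pverts = permutations_of_set {1..n},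
      parcs = {(u, v). u \<in> permutations_of_set {1..n} \<and> v \<in> permutations_of_set {1..n} \<and>
        (\<exists>i. Suc i < n \<and> v = u[i := u ! Suc i, Suc i := u ! i])} \<rparr>"

definition prefix_subnet :: "nat \<Rightarrow> nat \<Rightarrow> nat \<Rightarrow> nat list set" where
  "prefix_subnet n a b = {u \<in> pverts (bubble_sort n). u ! 0 = a \<and> u ! 1 = b}"

definition middle_subnet :: "nat \<Rightarrow> nat \<Rightarrow> nat \<Rightarrow> nat list set" where
  "middle_subnet n a b = {u \<in> pverts (bubble_sort n). u ! 0 = a \<and> u ! (n - 1) = b}"

definition suffix_subnet :: "nat \<Rightarrow> nat \<Rightarrow> nat \<Rightarrow> nat list set" where
  "suffix_subnet n a b = {u \<in> pverts (bubble_sort n). u ! (n - 2) = a \<and> u ! (n - 1) = b}"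

definition prefix_subnets :: "nat \<Rightarrow> nat list set set" where
  "prefix_subnets n = {prefix_subnet n a b | a b. a \<in> {1..n} \<and> b \<in> {1..n} \<and> a \<noteq> b}"

definition middle_subnets :: "nat \<Rightarrow> nat list set set" where
  "middle_subnets n = {middle_subnet n a b | a b. a \<in> {1..n} \<and> b \<in> {1..n} \<and> a \<noteq> b}"

definition suffix_subnets :: "nat \<Rightarrow> nat list set set" where
  "suffix_subnets n = {suffix_subnet n a b | a b. a \<in> {1..n} \<and> b \<in> {1..n} \<and> a \<noteq> b}"

text \<open>A state \<open>\<omega>\<close> maps a node to \<open>True\<close> iff it is fault-free. The default \<open>False\<close>
  only concerns lists that are not nodes of the network.\<close>

definition node_fault_model :: "'v pair_pre_digraph \<Rightarrow> real \<Rightarrow> ('v \<Rightarrow> bool) pmf" where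
  "node_fault_model G p = Pi_pmf (pverts G) False (\<lambda>_. bernoulli_pmf p)"

definition fault_free :: "('v \<Rightarrow> bool) \<Rightarrow> 'v set \<Rightarrow> bool" where
  "fault_free \<omega> H \<longleftrightarrow> (\<forall>v\<in>H. \<omega> v)"

text \<open>Subnetworks are identified with their vertex sets. For \<open>n \<ge> 4\<close> no vertex set has two
  of the three forms, so the three cardinalities classify the four members of \<open>S\<close>.\<close>

definition four_subnets :: "nat \<Rightarrow> nat \<Rightarrow> nat \<Rightarrow> nat \<Rightarrow> nat list set set set" where
  "four_subnets n i j k =
    {S. S \<subseteq> prefix_subnets n \<union> middle_subnets n \<union> suffix_subnets n \<and> card S = 4 \<and>
        card (S \<inter> prefix_subnets n) = i \<and>
        card (S \<inter> middle_subnets n) = j \<and>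
        card (S \<inter> suffix_subnets n) = k}"

text \<open>Only meaningful for \<open>i + j + k = 4\<close>. As a sum over all \<open>S\<close> it is an expected number of
  fault-free quadruples, not the probability that some quadruple is fault-free.\<close>

definition P :: "nat \<Rightarrow> real \<Rightarrow> nat \<Rightarrow> nat \<Rightarrow> nat \<Rightarrow> real" where
  "P n p i j k =
    (\<Sum>S\<in>four_subnets n i j k.
      measure_pmf.prob (node_fault_model (bubble_sort n) p) {\<omega>. \<forall>H\<in>S. fault_free \<omega> H})"

end

theory Submission imports Defs begin

text \<open>Subnetworks of equal form are pairwise disjoint, and a prefix subnetwork \<open>abX\<close> meets a
  suffix subnetwork \<open>Xcd\<close> iff \<open>a, b, c, d\<close> are distinct, the intersection having \<open>(n - 4)!\<close>
  vertices. So a quadruple has \<open>4(n - 2)! - m(n - 4)!\<close> vertices, where \<open>m\<close> of its three prefix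
  members meet the suffix member. Of the \<open>n(n - 1)\<close> prefix subnetworks, \<open>(n - 2)(n - 3)\<close> meet
  the given suffix subnetwork and \<open>4n - 6\<close> do not.\<close>

section \<open>Counting subsets, ordered pairs and permutations\<close>

text \<open>Splitting \<open>A\<close> into \<open>A \<inter> X\<close> and
  \<open>A \<inter> Y\<close> is inverse to taking unions, so both parts can be chosen
  independently. The bound \<open>m \<le> k\<close> keeps \<open>k - m\<close> from
  truncating.\<close>

lemma card_subsets_Un_by_Int:
  assumes "finite X" "finite Y" "X \<inter> Y = {}" "m \<le> k"
  shows "card {A. A \<subseteq> X \<union> Y \<and> card A = k \<and> card (A \<inter> X) = m}
    = (card X choose m) * (card Y choose (k - m))"
proof -
  let ?L = "{A. A \<subseteq> X \<union> Y \<and> card A = k \<and> card (A \<inter> X) = m}"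
  let ?R = "{B. B \<subseteq> X \<and> card B = m} \<times> {C. C \<subseteq> Y \<and> card C = k - m}"
  have "bij_betw (\<lambda>A. (A \<inter> X, A \<inter> Y)) ?L ?R"
  proof (rule bij_betw_byWitness[where f' = "\<lambda>(B, C). B \<union> C"])
    show "(\<lambda>A. (A \<inter> X, A \<inter> Y)) ` ?L \<subseteq> ?R"
    proof clarsimp
      fix A assume A: "A \<subseteq> X \<union> Y"
      have "card A = card (A \<inter> X) + card (A \<inter> Y)"
        using assms A by (subst card_Un_disjoint[symmetric]) (auto intro: arg_cong[where f = card])
      then show "card (A \<inter> Y) = card A - card (A \<inter> X)"
        by simp
    qed
    show "(\<lambda>(B, C). B \<union> C) ` ?R \<subseteq> ?L"
    proof clarsimp
      fix B C assume BC: "B \<subseteq> X" "C \<subseteq> Y" "card C = k - card B" "m = card B"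
      have "card (B \<union> C) = card B + card C"
        using assms BC by (intro card_Un_disjoint) (auto intro: finite_subset)
      moreover have "(B \<union> C) \<inter> X = B"
        using assms BC by blast
      ultimately show "B \<subseteq> X \<union> Y \<and> C \<subseteq> X \<union> Y \<and> card (B \<union> C) = k \<and> card ((B \<union> C) \<inter> X) = card B"
        using assms BC by auto
    qed
  qed (use assms in auto)
  then have "card ?L = card ?R"
    by (rule bij_betw_same_card)
  then show ?thesis
    using assms by (simp add: card_cartesian_product n_subsets)
qed

text \<open>A weighted Vandermonde identity: the summand is constant on each class of subsets with
  the same \<open>m = card (A \<inter> X)\<close>, and the previous lemma gives the size of that
  class.\<close>

lemma sum_subsets_by_Int:
  fixes f :: "nat \<Rightarrow> 'a::comm_semiring_1"
  assumes "finite Z" "X \<subseteq> Z"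
  shows "(\<Sum>A | A \<subseteq> Z \<and> card A = k. f (card (A \<inter> X)))
    = (\<Sum>m\<le>k. of_nat ((card X choose m) * (card (Z - X) choose (k - m))) * f m)"
proof -
  let ?S = "{A. A \<subseteq> Z \<and> card A = k}"
  have fin: "finite ?S"
    using assms by simp
  have "card (A \<inter> X) \<le> k" if "A \<in> ?S" for A
    using that assms by (auto intro: card_mono finite_subset)
  then have "(\<Sum>A\<in>?S. f (card (A \<inter> X)))
      = (\<Sum>m\<le>k. \<Sum>A | A \<in> ?S \<and> card (A \<inter> X) = m. f (card (A \<inter> X)))"
    using fin by (intro sum.group[symmetric]) auto
  also have "\<dots> = (\<Sum>m\<le>k. of_nat ((card X choose m) * (card (Z - X) choose (k - m))) * f m)"
  proof (rule sum.cong[OF refl])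
    fix m assume "m \<in> {..k}"
    moreover have "X \<union> (Z - X) = Z"
      using assms by blast
    ultimately have "card {A. A \<in> ?S \<and> card (A \<inter> X) = m}
        = (card X choose m) * (card (Z - X) choose (k - m))"
      using card_subsets_Un_by_Int[of X "Z - X" m k] assms finite_subset[of X Z]
      by (simp add: conj_assoc)
    then show "(\<Sum>A | A \<in> ?S \<and> card (A \<inter> X) = m. f (card (A \<inter> X)))
        = of_nat ((card X choose m) * (card (Z - X) choose (k - m))) * f m"
      by simp
  qed
  finally show ?thesis .
qed

lemma card_distinct_pairs:
  assumes "finite A"
  shows "card {(a, b). a \<in> A \<and> b \<in> A \<and> a \<noteq> b} = card A * (card A - 1)"
proof -
  have "{(a, b). a \<in> A \<and> b \<in> A \<and> a \<noteq> b} = (SIGMA a:A. A - {a})"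
    by auto
  then show ?thesis
    using assms by simp
qed

text \<open>Such a permutation is determined by its middle \<open>v\<close>, which ranges over the
  permutations of the remaining elements. With \<open>xs\<close> or \<open>ys\<close> empty this
  counts a subnetwork; with both of length two it counts the intersection of a prefix and a suffix
  subnetwork.\<close>

lemma card_permutations_of_set_fixed_ends:
  assumes "finite A" "distinct (xs @ ys)" "set (xs @ ys) \<subseteq> A"
  shows "card {u \<in> permutations_of_set A. \<exists>v. u = xs @ v @ ys} = fact (card A - length (xs @ ys))"
proof -
  have "{u \<in> permutations_of_set A. \<exists>v. u = xs @ v @ ys}
      = (\<lambda>v. xs @ v @ ys) ` permutations_of_set (A - set (xs @ ys))"
    using assms by (force simp: permutations_of_set_def)
  moreover have "card (A - set (xs @ ys)) = card A - length (xs @ ys)"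
    using assms by (subst card_Diff_subset) (auto simp: distinct_card simp del: set_append)
  ultimately show ?thesis
    using assms by (simp add: card_image inj_on_def)
qed

section \<open>Probability that a vertex set is fault-free\<close>

lemma prob_node_fault_model_fault_free:
  assumes "finite (pverts G)" "U \<subseteq> pverts G" "0 \<le> p" "p \<le> 1"
  shows "measure_pmf.prob (node_fault_model G p) {\<omega>. fault_free \<omega> U} = p ^ card U"
proof -
  \<comment> \<open>As a product event, with coordinates in \<open>U\<close> forced and the others
    free, its probability factors by independence. Since \<open>U\<close> consists of nodes, the
    default value \<open>False\<close> is never consulted.\<close>
  have "{\<omega>. fault_free \<omega> U} = Pi (pverts G) (\<lambda>v. if v \<in> U then {True} else UNIV)"
    using assms by (auto simp: fault_free_def Pi_def)
  then have "measure_pmf.prob (node_fault_model G p) {\<omega>. fault_free \<omega> U}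
      = (\<Prod>v\<in>pverts G. measure_pmf.prob (bernoulli_pmf p) (if v \<in> U then {True} else UNIV))"
    using assms by (simp add: node_fault_model_def measure_Pi_pmf_Pi)
  also have "\<dots> = (\<Prod>v\<in>pverts G. if v \<in> U then p else 1)"
    using assms by (intro prod.cong) (auto simp: measure_pmf_single)
  also have "\<dots> = (\<Prod>v\<in>U. p)"
    using assms by (simp add: prod.If_cases Int_absorb1)
  finally show ?thesis
    by simp
qed

section \<open>Vertices split at their first two and last two entries\<close>

text \<open>Length at least 4 keeps the two ends from overlapping, so one decomposition exposes
  every entry that any of the three forms prescribes.\<close>

lemma long_list_cases:
  assumes "4 \<le> length u"
  obtains x y w z t where "u = x # y # w @ [z, t]"
proof -
  obtain x y v where v: "u = x # y # v" "2 \<le> length v"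
    using assms by (auto simp: numeral_eq_Suc Suc_le_length_iff)
  obtain v' t where t: "v = v' @ [t]"
    using v by (cases v rule: rev_cases) auto
  then obtain w z where "v' = w @ [z]"
    using v by (cases v' rule: rev_cases) auto
  with v t that show thesis
    by simp
qed

lemma nth_long_list:
  "(x # y # w @ [z, t]) ! (length w + 2) = z" "(x # y # w @ [z, t]) ! (length w + 3) = t"
  by (simp_all add: nth_append numeral_eq_Suc)

context
  fixes n :: nat
  assumes n: "n \<ge> 4"
begin

lemma length_bubble_sort_vertex: "u \<in> pverts (bubble_sort n) \<Longrightarrow> length u = n"
  by (auto simp: bubble_sort_def length_finite_permutations_of_set)

lemma bubble_sort_vertexE:
  assumes "u \<in> pverts (bubble_sort n)"
  obtains x y w z t where "u = x # y # w @ [z, t]"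
  using long_list_cases[of u] that n length_bubble_sort_vertex[OF assms] by blast

lemma bubble_sort_vertex_iff:
  "x # y # w @ [z, t] \<in> pverts (bubble_sort n) \<longleftrightarrow>
    distinct (x # y # w @ [z, t]) \<and> set (x # y # w @ [z, t]) = {1..n}"
  by (auto simp: bubble_sort_def permutations_of_set_def)

lemma mem_subnet_iff:
  assumes "x # y # w @ [z, t] \<in> pverts (bubble_sort n)"
  shows "x # y # w @ [z, t] \<in> prefix_subnet n a b \<longleftrightarrow> x = a \<and> y = b"
    and "x # y # w @ [z, t] \<in> middle_subnet n a b \<longleftrightarrow> x = a \<and> t = b"
    and "x # y # w @ [z, t] \<in> suffix_subnet n a b \<longleftrightarrow> z = a \<and> t = b"
proof -
  \<comment> \<open>The length is \<open>n = length w + 4\<close>, so the zero-based positions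
    \<open>n - 2\<close> and \<open>n - 1\<close> are those of \<open>z\<close> and
    \<open>t\<close>.\<close>
  have "n - 2 = length w + 2" "n - 1 = length w + 3"
    using length_bubble_sort_vertex[OF assms] by auto
  then show "x # y # w @ [z, t] \<in> prefix_subnet n a b \<longleftrightarrow> x = a \<and> y = b"
    "x # y # w @ [z, t] \<in> middle_subnet n a b \<longleftrightarrow> x = a \<and> t = b"
    "x # y # w @ [z, t] \<in> suffix_subnet n a b \<longleftrightarrow> z = a \<and> t = b"
    using assms nth_long_list[of x y w z t]
    by (simp_all only: prefix_subnet_def middle_subnet_def suffix_subnet_def) simp_all
qed

lemma subnet_subset_pverts:
  "prefix_subnet n a b \<subseteq> pverts (bubble_sort n)" "suffix_subnet n a b \<subseteq> pverts (bubble_sort n)"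
  by (auto simp: prefix_subnet_def suffix_subnet_def)

lemma finite_pverts_bubble_sort: "finite (pverts (bubble_sort n))"
  by (simp add: bubble_sort_def)

section \<open>Sizes of subnetworks and of their intersections\<close>

text \<open>The trailing \<open>@ []\<close> gives the set the shape counted by
  \<open>card_permutations_of_set_fixed_ends\<close>.\<close>

lemma prefix_subnet_altdef:
  "prefix_subnet n a b = {u \<in> permutations_of_set {1..n}. \<exists>v. u = [a, b] @ v @ []}"
proof -
  have "u \<in> prefix_subnet n a b \<longleftrightarrow> (\<exists>v. u = [a, b] @ v @ [])" if u_vert: "u \<in> pverts (bubble_sort n)" for u
  proof -
    obtain x y w z t where u: "u = x # y # w @ [z, t]"
      using u_vert by (rule bubble_sort_vertexE)
    show ?thesis
      using u_vert unfolding u by (simp add: mem_subnet_iff)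
  qed
  then show ?thesis
    using subnet_subset_pverts(1) by (fastforce simp: bubble_sort_def)
qed

lemma suffix_subnet_altdef:
  "suffix_subnet n c d = {u \<in> permutations_of_set {1..n}. \<exists>v. u = [] @ v @ [c, d]}"
proof -
  have "u \<in> suffix_subnet n c d \<longleftrightarrow> (\<exists>v. u = [] @ v @ [c, d])" if u_vert: "u \<in> pverts (bubble_sort n)" for u
  proof -
    obtain x y w z t where u: "u = x # y # w @ [z, t]"
      using u_vert by (rule bubble_sort_vertexE)
    \<comment> \<open>The final segments \<open>[z, t]\<close> and \<open>[c, d]\<close> have equal
      length, so they can be compared directly.\<close>
    have "(\<exists>v. u = v @ [c, d]) \<longleftrightarrow> z = c \<and> t = d"
      using append_eq_append_conv[of "[z, t]" "[c, d]" "x # y # w"] unfolding u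
      by (metis append_Cons append_eq_append_conv length_Cons list.inject)
    then show ?thesis
      using u_vert unfolding u by (simp add: mem_subnet_iff)
  qed
  then show ?thesis
    using subnet_subset_pverts(2) by (fastforce simp: bubble_sort_def)
qed

lemma prefix_Int_suffix_subnet_altdef:
  "prefix_subnet n a b \<inter> suffix_subnet n c d
    = {u \<in> permutations_of_set {1..n}. \<exists>v. u = [a, b] @ v @ [c, d]}"
proof -
  have "u \<in> prefix_subnet n a b \<inter> suffix_subnet n c d \<longleftrightarrow> (\<exists>v. u = [a, b] @ v @ [c, d])"
    if u_vert: "u \<in> pverts (bubble_sort n)" for u
  proof -
    obtain x y w z t where u: "u = x # y # w @ [z, t]"
      using u_vert by (rule bubble_sort_vertexE)
    show ?thesis
      using u_vert unfolding u by (auto simp: mem_subnet_iff)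
  qed
  then show ?thesis
    using subnet_subset_pverts by (fastforce simp: bubble_sort_def)
qed

lemma card_prefix_subnet:
  assumes "a \<in> {1..n}" "b \<in> {1..n}" "a \<noteq> b"
  shows "card (prefix_subnet n a b) = fact (n - 2)"
  using assms card_permutations_of_set_fixed_ends[of "{1..n}" "[a, b]" "[]"]
  by (simp add: prefix_subnet_altdef numeral_2_eq_2)

lemma card_suffix_subnet:
  assumes "c \<in> {1..n}" "d \<in> {1..n}" "c \<noteq> d"
  shows "card (suffix_subnet n c d) = fact (n - 2)"
  using assms card_permutations_of_set_fixed_ends[of "{1..n}" "[]" "[c, d]"]
  by (simp add: suffix_subnet_altdef numeral_2_eq_2)

lemma card_prefix_Int_suffix_subnet:
  assumes "a \<in> {1..n}" "b \<in> {1..n}" "a \<noteq> b" "c \<in> {1..n}" "d \<in> {1..n}" "c \<noteq> d"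
  shows "card (prefix_subnet n a b \<inter> suffix_subnet n c d)
    = (if {a, b} \<inter> {c, d} = {} then fact (n - 4) else 0)"
proof (cases "{a, b} \<inter> {c, d} = {}")
  case True
  then have "card (prefix_subnet n a b \<inter> suffix_subnet n c d)
      = fact (card {1..n} - length ([a, b] @ [c, d]))"
    unfolding prefix_Int_suffix_subnet_altdef
    using assms by (intro card_permutations_of_set_fixed_ends) auto
  with True show ?thesis
    by (simp add: numeral_eq_Suc)
next
  case False
  \<comment> \<open>A value common to both pairs would occur at the front and again at the end of a
    list with distinct entries.\<close>
  then have "prefix_subnet n a b \<inter> suffix_subnet n c d = {}"
    unfolding prefix_Int_suffix_subnet_altdef by (auto simp: permutations_of_set_def)
  with False show ?thesis
    by simp
qed

section \<open>Telling the three forms apart\<close>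

text \<open>The subnetwork is nonempty because its size is a factorial. The sample vertex serves to
  distinguish subnetworks from each other.\<close>

lemma prefix_subnet_vertexE:
  assumes "a \<in> {1..n}" "b \<in> {1..n}" "a \<noteq> b"
  obtains x y w z t where "x # y # w @ [z, t] \<in> pverts (bubble_sort n)"
    "x # y # w @ [z, t] \<in> prefix_subnet n a b"
proof -
  have "prefix_subnet n a b \<noteq> {}"
    using card_prefix_subnet[OF assms] by (metis card.empty fact_nonzero)
  then show thesis
    using that bubble_sort_vertexE subnet_subset_pverts by (metis ex_in_conv subsetD)
qed

lemma suffix_subnet_vertexE:
  assumes "a \<in> {1..n}" "b \<in> {1..n}" "a \<noteq> b"
  obtains x y w z t where "x # y # w @ [z, t] \<in> pverts (bubble_sort n)"
    "x # y # w @ [z, t] \<in> suffix_subnet n a b"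
proof -
  have "suffix_subnet n a b \<noteq> {}"
    using card_suffix_subnet[OF assms] by (metis card.empty fact_nonzero)
  then show thesis
    using that bubble_sort_vertexE subnet_subset_pverts by (metis ex_in_conv subsetD)
qed

text \<open>The three forms are told apart by exchanging the first two or the last two entries of
  a vertex; for \<open>n \<ge> 4\<close> these positions do not overlap.\<close>

lemma swap_ends_in_pverts:
  assumes "x # y # w @ [z, t] \<in> pverts (bubble_sort n)"
  shows "x # y # w @ [t, z] \<in> pverts (bubble_sort n)" "y # x # w @ [z, t] \<in> pverts (bubble_sort n)"
    "z \<noteq> t" "x \<noteq> y"
  using assms unfolding bubble_sort_vertex_iff by auto

lemma prefix_subnet_neq:
  assumes "a \<in> {1..n}" "b \<in> {1..n}" "a \<noteq> b"
  shows "prefix_subnet n a b \<noteq> middle_subnet n c d" "prefix_subnet n a b \<noteq> suffix_subnet n c d"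
proof -
  obtain x y w z t where u: "x # y # w @ [z, t] \<in> pverts (bubble_sort n)"
    "x # y # w @ [z, t] \<in> prefix_subnet n a b"
    using prefix_subnet_vertexE assms by blast
  note u' = swap_ends_in_pverts[OF u(1)]
  \<comment> \<open>The vertex and its swap both lie in the prefix subnetwork but end in the
    distinct values \<open>t\<close> and \<open>z\<close>, whereas a middle or suffix subnetwork
    fixes the last entry.\<close>
  have "x # y # w @ [t, z] \<in> prefix_subnet n a b"
    using u u' by (simp add: mem_subnet_iff)
  then show "prefix_subnet n a b \<noteq> middle_subnet n c d" "prefix_subnet n a b \<noteq> suffix_subnet n c d"
    using u u' by (metis mem_subnet_iff(2), metis mem_subnet_iff(3))
qed

lemma suffix_subnet_neq_middle_subnet:
  assumes "a \<in> {1..n}" "b \<in> {1..n}" "a \<noteq> b"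
  shows "suffix_subnet n a b \<noteq> middle_subnet n c d"
proof -
  obtain x y w z t where u: "x # y # w @ [z, t] \<in> pverts (bubble_sort n)"
    "x # y # w @ [z, t] \<in> suffix_subnet n a b"
    using suffix_subnet_vertexE assms by blast
  note u' = swap_ends_in_pverts[OF u(1)]
  \<comment> \<open>Here the two members differ in the first entry, which a middle subnetwork
    fixes.\<close>
  have "y # x # w @ [z, t] \<in> suffix_subnet n a b"
    using u u' by (simp add: mem_subnet_iff)
  then show ?thesis
    using u u' by (metis mem_subnet_iff(2))
qed

lemma subnets_disjoint:
  "prefix_subnets n \<inter> middle_subnets n = {}"
  "prefix_subnets n \<inter> suffix_subnets n = {}"
  "suffix_subnets n \<inter> middle_subnets n = {}"
  using prefix_subnet_neq suffix_subnet_neq_middle_subnet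
  unfolding prefix_subnets_def middle_subnets_def suffix_subnets_def by blast+

section \<open>Subnetworks parametrized by ordered pairs\<close>

text \<open>The first two entries of any one vertex recover \<open>(a, b)\<close>. Counting
  subnetworks thereby becomes counting ordered pairs.\<close>

lemma inj_on_prefix_subnet:
  "inj_on (\<lambda>(a, b). prefix_subnet n a b) {(a, b). a \<in> {1..n} \<and> b \<in> {1..n} \<and> a \<noteq> b}"
proof (rule inj_onI, clarify)
  fix a b a' b'
  assume "a \<in> {1..n}" "b \<in> {1..n}" "a \<noteq> b" and eq: "prefix_subnet n a b = prefix_subnet n a' b'"
  then obtain x y w z t where "x # y # w @ [z, t] \<in> pverts (bubble_sort n)"
    "x # y # w @ [z, t] \<in> prefix_subnet n a b"
    using prefix_subnet_vertexE by blast
  then show "a = a' \<and> b = b'"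
    using eq by (metis mem_subnet_iff(1))
qed

lemma inj_on_suffix_subnet:
  "inj_on (\<lambda>(a, b). suffix_subnet n a b) {(a, b). a \<in> {1..n} \<and> b \<in> {1..n} \<and> a \<noteq> b}"
proof (rule inj_onI, clarify)
  fix a b a' b'
  assume "a \<in> {1..n}" "b \<in> {1..n}" "a \<noteq> b" and eq: "suffix_subnet n a b = suffix_subnet n a' b'"
  then obtain x y w z t where "x # y # w @ [z, t] \<in> pverts (bubble_sort n)"
    "x # y # w @ [z, t] \<in> suffix_subnet n a b"
    using suffix_subnet_vertexE by blast
  then show "a = a' \<and> b = b'"
    using eq by (metis mem_subnet_iff(3))
qed

lemma prefix_subnets_eq_image:
  "prefix_subnets n = (\<lambda>(a, b). prefix_subnet n a b) `
    {(a, b). a \<in> {1..n} \<and> b \<in> {1..n} \<and> a \<noteq> b}"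
  by (auto simp: prefix_subnets_def)

lemma suffix_subnets_eq_image:
  "suffix_subnets n = (\<lambda>(a, b). suffix_subnet n a b) `
    {(a, b). a \<in> {1..n} \<and> b \<in> {1..n} \<and> a \<noteq> b}"
  by (auto simp: suffix_subnets_def)

lemma card_prefix_subnets: "card (prefix_subnets n) = n * (n - 1)"
  unfolding prefix_subnets_eq_image card_image[OF inj_on_prefix_subnet]
  using card_distinct_pairs[of "{1..n}"] by simp

lemma card_suffix_subnets: "card (suffix_subnets n) = n * (n - 1)"
  unfolding suffix_subnets_eq_image card_image[OF inj_on_suffix_subnet]
  using card_distinct_pairs[of "{1..n}"] by simp

lemma finite_distinct_pairs:
  "finite {(a, b). a \<in> {1..n} \<and> b \<in> {1..n} \<and> a \<noteq> b}"
  by (rule finite_subset[of _ "{1..n} \<times> {1..n}"]) auto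

lemma finite_subnets: "finite (prefix_subnets n)" "finite (suffix_subnets n)"
  unfolding prefix_subnets_eq_image suffix_subnets_eq_image
  using finite_distinct_pairs by blast+

lemma members_subset_pverts:
  "K \<in> prefix_subnets n \<union> suffix_subnets n \<Longrightarrow> K \<subseteq> pverts (bubble_sort n)"
  by (auto simp: prefix_subnets_def suffix_subnets_def prefix_subnet_def suffix_subnet_def)

lemma finite_members: "K \<in> prefix_subnets n \<union> suffix_subnets n \<Longrightarrow> finite K"
  using members_subset_pverts finite_subset finite_pverts_bubble_sort by blast

section \<open>Prefix subnetworks that meet a given suffix subnetwork\<close>

definition meeting_prefix_subnets :: "nat list set \<Rightarrow> nat list set set" where
  "meeting_prefix_subnets H = {K \<in> prefix_subnets n. K \<inter> H \<noteq> {}}"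

lemma card_prefix_Int_suffix:
  assumes "K \<in> prefix_subnets n" "H \<in> suffix_subnets n"
  shows "card (K \<inter> H) = (if K \<in> meeting_prefix_subnets H then fact (n - 4) else 0)"
proof -
  obtain a b c d where "K = prefix_subnet n a b" "a \<in> {1..n}" "b \<in> {1..n}" "a \<noteq> b"
    "H = suffix_subnet n c d" "c \<in> {1..n}" "d \<in> {1..n}" "c \<noteq> d"
    using assms by (auto simp: prefix_subnets_def suffix_subnets_def)
  then have "card (K \<inter> H) = fact (n - 4) \<or> card (K \<inter> H) = 0"
    using card_prefix_Int_suffix_subnet[of a b c d] by auto
  \<comment> \<open>Finiteness makes cardinality 0 equivalent to emptiness.\<close>
  moreover have "finite (K \<inter> H)"
    using finite_members assms by blast
  ultimately have "card (K \<inter> H) = (if K \<inter> H \<noteq> {} then fact (n - 4) else 0)"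
    by auto
  then show ?thesis
    using assms by (simp add: meeting_prefix_subnets_def)
qed

text \<open>Meeting \<open>suffix_subnet n c d\<close> means that \<open>a\<close> and
  \<open>b\<close> avoid \<open>c\<close> and \<open>d\<close>, which leaves ordered pairs of
  distinct elements from a set of size \<open>n - 2\<close>. The count is the same for every
  \<open>H\<close>.\<close>

lemma card_meeting_prefix_subnets:
  assumes "H \<in> suffix_subnets n"
  shows "card (meeting_prefix_subnets H) = (n - 2) * (n - 3)"
proof -
  obtain c d where cd: "H = suffix_subnet n c d" "c \<in> {1..n}" "d \<in> {1..n}" "c \<noteq> d"
    using assms by (auto simp: suffix_subnets_def)
  let ?A = "{1..n} - {c, d}"
  have meets: "prefix_subnet n a b \<inter> H \<noteq> {} \<longleftrightarrow> {a, b} \<inter> {c, d} = {}"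
    if "a \<in> {1..n}" "b \<in> {1..n}" "a \<noteq> b" for a b
  proof -
    have "finite (prefix_subnet n a b \<inter> H)"
      using finite_pverts_bubble_sort subnet_subset_pverts by (meson finite_Int finite_subset)
    then show ?thesis
      using card_prefix_Int_suffix_subnet[OF that cd(2-4)] cd(1)
      by (metis card_0_eq fact_nonzero)
  qed
  have "meeting_prefix_subnets H = (\<lambda>(a, b). prefix_subnet n a b) `
      {(a, b). a \<in> ?A \<and> b \<in> ?A \<and> a \<noteq> b}"
    using meets by (auto simp: meeting_prefix_subnets_def prefix_subnets_eq_image image_iff)
  moreover have "inj_on (\<lambda>(a, b). prefix_subnet n a b) {(a, b). a \<in> ?A \<and> b \<in> ?A \<and> a \<noteq> b}"
    by (rule inj_on_subset[OF inj_on_prefix_subnet]) auto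
  moreover have "card ?A = n - 2"
    using cd by (subst card_Diff_subset) auto
  ultimately show ?thesis
    using card_distinct_pairs[of ?A] by (simp add: card_image numeral_eq_Suc)
qed

section \<open>Size of the union of a quadruple\<close>

lemma card_Union_prefix_Un_suffix:
  assumes "\<A> \<subseteq> prefix_subnets n" "card \<A> = 3" "H \<in> suffix_subnets n"
  shows "card (\<Union>\<A> \<union> H)
    = 4 * fact (n - 2) - card (\<A> \<inter> meeting_prefix_subnets H) * fact (n - 4)"
proof -
  have finA: "finite \<A>"
    using assms finite_subnets finite_subset by blast
  have fin: "finite H" "\<And>K. K \<in> \<A> \<Longrightarrow> finite K"
    using assms finite_members by blast+
  \<comment> \<open>Different members prescribe different first two entries, so only intersections
    with \<open>H\<close> need correction.\<close>
  have disj: "K \<inter> L = {}" if KL: "K \<in> \<A>" "L \<in> \<A>" "K \<noteq> L" for K L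
  proof -
    obtain a b a' b' where "K = prefix_subnet n a b" "L = prefix_subnet n a' b'"
      using KL assms(1) by (force simp: prefix_subnets_def)
    with KL(3) show ?thesis
      by (auto simp: prefix_subnet_def)
  qed
  have "card (\<Union>\<A>) = (\<Sum>K\<in>\<A>. card K)"
    using fin disj by (intro card_Union_disjoint) (simp_all add: pairwise_def disjnt_def)
  also have "\<dots> = (\<Sum>K\<in>\<A>. fact (n - 2))"
    using assms(1) card_prefix_subnet by (intro sum.cong) (auto simp: prefix_subnets_def)
  finally have U: "card (\<Union>\<A>) = 3 * fact (n - 2)"
    using assms by simp
  have "card (\<Union>\<A> \<inter> H) = card (\<Union>K\<in>\<A>. K \<inter> H)"
    by (rule arg_cong[where f = card]) auto
  also have "\<dots> = (\<Sum>K\<in>\<A>. card (K \<inter> H))"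
    using fin(2) disj finA by (intro card_UN_disjoint) (simp, simp, blast)
  also have "\<dots> = (\<Sum>K\<in>\<A>. if K \<in> meeting_prefix_subnets H then fact (n - 4) else 0)"
    using assms card_prefix_Int_suffix by (intro sum.cong) auto
  also have "\<dots> = card (\<A> \<inter> meeting_prefix_subnets H) * fact (n - 4)"
    using finA by (simp add: sum.If_cases)
  finally have I: "card (\<Union>\<A> \<inter> H) = card (\<A> \<inter> meeting_prefix_subnets H) * fact (n - 4)" .
  have H: "card H = fact (n - 2)"
    using assms card_suffix_subnet by (auto simp: suffix_subnets_def)
  \<comment> \<open>This additive form also shows that the subtraction in the claim does not
    truncate.\<close>
  have "card (\<Union>\<A>) + card H = card (\<Union>\<A> \<union> H) + card (\<Union>\<A> \<inter> H)"
    using fin finA by (intro card_Un_Int) auto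
  then show ?thesis
    unfolding U I H by simp
qed

section \<open>Summation over quadruples\<close>

text \<open>Since the forms are disjoint, intersecting a quadruple with each form recovers the
  suffix member and the prefix triple. The sum over quadruples thus becomes a double sum.\<close>

lemma bij_betw_four_subnets:
  "bij_betw (\<lambda>(H, \<A>). insert H \<A>)
    (suffix_subnets n \<times> {\<A>. \<A> \<subseteq> prefix_subnets n \<and> card \<A> = 3}) (four_subnets n 3 0 1)"
proof (rule bij_betw_imageI)
  let ?D = "suffix_subnets n \<times> {\<A>. \<A> \<subseteq> prefix_subnets n \<and> card \<A> = 3}"
  show "inj_on (\<lambda>(H, \<A>). insert H \<A>) ?D"
  proof (rule inj_on_inverseI[where g = "\<lambda>S. (the_elem (S \<inter> suffix_subnets n), S \<inter> prefix_subnets n)"])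
    fix x assume "x \<in> ?D"
    then obtain H \<A> where x: "x = (H, \<A>)" "H \<in> suffix_subnets n" "\<A> \<subseteq> prefix_subnets n"
      by auto
    then have "insert H \<A> \<inter> suffix_subnets n = {H}" "insert H \<A> \<inter> prefix_subnets n = \<A>"
      using subnets_disjoint(2) by blast+
    then show "(the_elem ((case x of (H, \<A>) \<Rightarrow> insert H \<A>) \<inter> suffix_subnets n),
        (case x of (H, \<A>) \<Rightarrow> insert H \<A>) \<inter> prefix_subnets n) = x"
      unfolding x by (simp del: Int_insert_left)
  qed
  show "(\<lambda>(H, \<A>). insert H \<A>) ` ?D = four_subnets n 3 0 1"
  proof (intro equalityI subsetI)
    fix S assume "S \<in> (\<lambda>(H, \<A>). insert H \<A>) ` ?D"
    then obtain H \<A> where S: "S = insert H \<A>" "H \<in> suffix_subnets n"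
      and A: "\<A> \<subseteq> prefix_subnets n" "card \<A> = 3"
      by auto
    have "finite \<A>" "H \<notin> \<A>"
      using S A subnets_disjoint(2) finite_subnets finite_subset by blast+
    moreover have "S \<inter> prefix_subnets n = \<A>" "S \<inter> middle_subnets n = {}"
      "S \<inter> suffix_subnets n = {H}"
      using S A subnets_disjoint by blast+
    ultimately show "S \<in> four_subnets n 3 0 1"
      using S A by (auto simp: four_subnets_def)
  next
    fix S assume "S \<in> four_subnets n 3 0 1"
    then have S: "S \<subseteq> prefix_subnets n \<union> middle_subnets n \<union> suffix_subnets n" "card S = 4"
      "card (S \<inter> prefix_subnets n) = 3" "card (S \<inter> middle_subnets n) = 0"
      "card (S \<inter> suffix_subnets n) = 1"
      by (auto simp: four_subnets_def)
    \<comment> \<open>An infinite set has cardinality 0, so \<open>card S = 4\<close> forces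
      finiteness; only then does the zero count of middle members mean that there are none.\<close>
    have "finite S"
      using S(2) by (metis card.infinite zero_neq_numeral)
    then have "S \<inter> middle_subnets n = {}"
      using S(4) by simp
    moreover obtain H where "S \<inter> suffix_subnets n = {H}"
      using S(5) card_1_singletonE by blast
    ultimately have "S = insert H (S \<inter> prefix_subnets n)" "H \<in> suffix_subnets n"
      using S(1) by blast+
    then show "S \<in> (\<lambda>(H, \<A>). insert H \<A>) ` ?D"
      using S(3) by (intro image_eqI[of _ _ "(H, S \<inter> prefix_subnets n)"]) auto
  qed
qed

text \<open>For a fixed suffix member \<open>H\<close>, the probability depends only on the number
  \<open>m\<close> of prefix members meeting \<open>H\<close>. The resulting inner sum is the same
  for every \<open>H\<close>, hence the factor \<open>n * (n - 1)\<close>.\<close>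

lemma P_3_0_1_eq_sum:
  assumes "0 \<le> p" "p \<le> 1"
  shows "P n p 3 0 1 = real (n * (n - 1)) *
    (\<Sum>m\<le>3. real (((n - 2) * (n - 3) choose m) * ((4 * n - 6) choose (3 - m))) *
      p ^ (4 * fact (n - 2) - m * fact (n - 4)))"
proof -
  let ?Q = "{\<A>. \<A> \<subseteq> prefix_subnets n \<and> card \<A> = 3}"
  let ?f = "\<lambda>m. p ^ (4 * fact (n - 2) - m * fact (n - 4))"
  have "P n p 3 0 1 = (\<Sum>(H, \<A>)\<in>suffix_subnets n \<times> ?Q.
      measure_pmf.prob (node_fault_model (bubble_sort n) p) {\<omega>. \<forall>K\<in>insert H \<A>. fault_free \<omega> K})"
    unfolding P_def sum.reindex_bij_betw[OF bij_betw_four_subnets, symmetric]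
    by (simp add: case_prod_unfold)
  also have "\<dots> = (\<Sum>(H, \<A>)\<in>suffix_subnets n \<times> ?Q. ?f (card (\<A> \<inter> meeting_prefix_subnets H)))"
  proof (intro sum.cong refl, clarify)
    fix H \<A> assume A: "H \<in> suffix_subnets n" "\<A> \<subseteq> prefix_subnets n" "card \<A> = 3"
    \<comment> \<open>Joint fault-freeness is fault-freeness of the union, so only the size of the
      union matters.\<close>
    have "{\<omega>. \<forall>K\<in>insert H \<A>. fault_free \<omega> K} = {\<omega>. fault_free \<omega> (\<Union>\<A> \<union> H)}"
      by (auto simp: fault_free_def)
    moreover have "\<Union>\<A> \<union> H \<subseteq> pverts (bubble_sort n)"
      using A members_subset_pverts by blast
    ultimately show "measure_pmf.prob (node_fault_model (bubble_sort n) p)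
        {\<omega>. \<forall>K\<in>insert H \<A>. fault_free \<omega> K} = ?f (card (\<A> \<inter> meeting_prefix_subnets H))"
      using assms finite_pverts_bubble_sort card_Union_prefix_Un_suffix[OF A(2,3,1)]
      by (simp add: prob_node_fault_model_fault_free)
  qed
  also have "\<dots> = (\<Sum>H\<in>suffix_subnets n. \<Sum>\<A>\<in>?Q. ?f (card (\<A> \<inter> meeting_prefix_subnets H)))"
    by (rule sum.cartesian_product[symmetric])
  also have "\<dots> = (\<Sum>H\<in>suffix_subnets n. \<Sum>m\<le>3.
      real (((n - 2) * (n - 3) choose m) * ((4 * n - 6) choose (3 - m))) * ?f m)"
  proof (intro sum.cong refl)
    fix H assume H: "H \<in> suffix_subnets n"
    let ?X = "meeting_prefix_subnets H"
    have X: "?X \<subseteq> prefix_subnets n"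
      by (auto simp: meeting_prefix_subnets_def)
    \<comment> \<open>Writing \<open>n\<close> as \<open>k + 4\<close> removes truncated
      subtraction: the difference below is \<open>4 * k + 10\<close>, that is,
      \<open>4 * n - 6\<close>.\<close>
    obtain k where k: "n = k + 4"
      using n by (metis add.commute le_Suc_ex)
    have "card (prefix_subnets n - ?X) = n * (n - 1) - (n - 2) * (n - 3)"
      using X H finite_subnets finite_subset
      by (metis card_Diff_subset card_meeting_prefix_subnets card_prefix_subnets)
    also have "\<dots> = 4 * n - 6"
      unfolding k by (simp add: algebra_simps)
    finally have Y: "card (prefix_subnets n - ?X) = 4 * n - 6" .
    show "(\<Sum>\<A>\<in>?Q. ?f (card (\<A> \<inter> ?X)))
        = (\<Sum>m\<le>3. real (((n - 2) * (n - 3) choose m) * ((4 * n - 6) choose (3 - m))) * ?f m)"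
      using sum_subsets_by_Int[OF finite_subnets(1) X, of ?f 3]
      unfolding Y card_meeting_prefix_subnets[OF H] .
  qed
  finally show ?thesis
    by (simp add: card_suffix_subnets)
qed

end

section \<open>Expansion of the binomials into polynomials\<close>

lemma atMost_3: "{..3::nat} = {0, 1, 2, 3}"
  by auto

lemma real_choose_two: "real (m choose 2) = real m * (real m - 1) / 2"
  by (induction m) (simp_all add: numeral_2_eq_2 field_simps)

text \<open>Induction by Pascal's rule. Real subtraction makes the formula valid for
  \<open>m < 3\<close> as well, where both sides vanish; this covers \<open>n = 4\<close>, where
  only two prefix subnetworks meet \<open>H\<close>.\<close>

lemma real_choose_three: "real (m choose 3) = real m * (real m - 1) * (real m - 2) / 6"
proof (induction m)
  case (Suc m)
  have "Suc m choose 3 = (m choose 2) + (m choose 3)"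
    by (simp add: numeral_3_eq_3 numeral_2_eq_2)
  then show ?case
    using Suc by (simp add: real_choose_two field_simps)
qed simp

theorem theorem4:
  fixes n :: nat and p :: real
  assumes "n \<ge> 4" and "0 \<le> p" and "p \<le> 1"
  shows "P n p 3 0 1 =
      4 / 3 * (8 * real n ^ 5 - 50 * real n ^ 4 + 115 * real n ^ 3 - 115 * real n ^ 2 + 42 * real n)
        * p ^ (4 * fact (n - 2))
    + (8 * real n ^ 6 - 74 * real n ^ 5 + 265 * real n ^ 4 - 460 * real n ^ 3 + 387 * real n ^ 2
        - 126 * real n)
        * p ^ (4 * fact (n - 2) - fact (n - 4))
    + (2 * real n ^ 7 - 25 * real n ^ 6 + 125 * real n ^ 5 - 320 * real n ^ 4 + 443 * real n ^ 3
        - 315 * real n ^ 2 + 90 * real n)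
        * p ^ (4 * fact (n - 2) - 2 * fact (n - 4))
    + 1 / 6 * (real n ^ 8 - 16 * real n ^ 7 + 105 * real n ^ 6 - 365 * real n ^ 5 + 724 * real n ^ 4
        - 819 * real n ^ 3 + 490 * real n ^ 2 - 120 * real n)
        * p ^ (4 * fact (n - 2) - 3 * fact (n - 4))"
proof -
  \<comment> \<open>\<open>D\<close> and \<open>E\<close> count the prefix subnetworks that meet and
    miss the suffix member; \<open>d\<close> and \<open>e\<close> are their values as real
    polynomials, equal to them because \<open>n \<ge> 4\<close> rules out truncation.\<close>
  define D E where "D = (n - 2) * (n - 3)" and "E = 4 * n - 6"
  define d e :: real where "d = (real n - 2) * (real n - 3)" and "e = 4 * real n - 6"
  have d: "real D = d" and e: "real E = e"
    and n1: "real (n * (n - 1)) = real n * (real n - 1)"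
    using assms by (simp_all add: D_def E_def d_def e_def of_nat_diff)
  define q where "q m = p ^ (4 * fact (n - 2) - m * fact (n - 4))" for m :: nat
  have "P n p 3 0 1 = real (n * (n - 1)) *
      (\<Sum>m\<le>3. real ((D choose m) * (E choose (3 - m))) * q m)"
    using P_3_0_1_eq_sum[OF assms] by (simp add: q_def D_def E_def)
  also have "\<dots> = real n * (real n - 1) * (e * (e - 1) * (e - 2) / 6 * q 0
      + d * (e * (e - 1) / 2) * q 1 + d * (d - 1) / 2 * e * q 2 + d * (d - 1) * (d - 2) / 6 * q 3)"
    unfolding n1 by (simp add: atMost_3 real_choose_two real_choose_three d e)
  also have "\<dots> = real n * (real n - 1) * (e * (e - 1) * (e - 2) / 6) * q 0
      + real n * (real n - 1) * (d * (e * (e - 1) / 2)) * q 1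
      + real n * (real n - 1) * (d * (d - 1) / 2 * e) * q 2
      + real n * (real n - 1) * (d * (d - 1) * (d - 2) / 6) * q 3"
    by (simp only: distrib_left mult.assoc)
  \<comment> \<open>Only now are \<open>d\<close> and \<open>e\<close> expanded: the coefficient of
    each \<open>q m\<close> is a separate polynomial identity in \<open>real n\<close>.\<close>
  also have "real n * (real n - 1) * (e * (e - 1) * (e - 2) / 6) =
      4 / 3 * (8 * real n ^ 5 - 50 * real n ^ 4 + 115 * real n ^ 3 - 115 * real n ^ 2 + 42 * real n)"
    unfolding e_def by (simp add: field_simps power_numeral_reduce)
  also have "real n * (real n - 1) * (d * (e * (e - 1) / 2)) =
      8 * real n ^ 6 - 74 * real n ^ 5 + 265 * real n ^ 4 - 460 * real n ^ 3 + 387 * real n ^ 2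
        - 126 * real n"
    unfolding d_def e_def by (simp add: field_simps power_numeral_reduce)
  also have "real n * (real n - 1) * (d * (d - 1) / 2 * e) =
      2 * real n ^ 7 - 25 * real n ^ 6 + 125 * real n ^ 5 - 320 * real n ^ 4 + 443 * real n ^ 3
        - 315 * real n ^ 2 + 90 * real n"
    unfolding d_def e_def by (simp add: field_simps power_numeral_reduce)
  also have "real n * (real n - 1) * (d * (d - 1) * (d - 2) / 6) =
      1 / 6 * (real n ^ 8 - 16 * real n ^ 7 + 105 * real n ^ 6 - 365 * real n ^ 5 + 724 * real n ^ 4
        - 819 * real n ^ 3 + 490 * real n ^ 2 - 120 * real n)"
    unfolding d_def by (simp add: field_simps power_numeral_reduce)
  finally show ?thesis
    by (simp add: q_def)
qed

end
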